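(* Let $G=(X\cup Y,E)$ be a complete bipartite graph and $\mathcal{I}$ a partition of $X$. Let $m\ge 2$, let $I_1,\ldots,I_m\in\mathcal{I}$ be pairwise distinct, $i_1\in I_1,\ldots,i_m\in I_m$, and let $j_1,\ldots,j_m\in Y$ be pairwise distinct. Then the inequality $$-y_{j_1}-\sum_{k=1}^m(m-k)\,x_{i_k}-\sum_{\substack{2\le p,k\le m:\\ p+k=m+2}}z_{i_pj_k}+\sum_{\substack{1\le p,k\le m:\\ p+k<m+2}}z_{i_pj_k}\le 0$$ defines a facet of $P(G,\mathcal{I})$.
   Context: $G=(X\cup Y,E)$ is a finite complete bipartite graph with disjoint node sets $X,Y$, i.e. $E=\{\{i,j\}: i\in X, j\in Y\}$. $\mathcal{I}$ is a partition of $X$ into non-empty subsets. Vectors in $\mathbb{R}^{X\cup Y\cup E}$ are written $(x,y,z)$. Put $X^{\mathcal{I}}=\{x\in\{0,1\}^X : \sum_{i\in I}x_i\le 1\ \forall I\in\mathcal{I}\}$ and $$P(G,\mathcal{I})=\operatorname{conv}\{(x,y,z)\in\{0,1\}^{X\cup Y\cup E} : x_iy_j=z_{ij}\ \forall\{i,j\}\in E,\ x\in X^{\mathcal{I}}\}.$$ *)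

theory Defs
  imports "HOL-Analysis.Analysis" "HOL-Library.Disjoint_Sets"
begin

text \<open>
  The complete bipartite graph \<open>G = (X \<union> Y, E)\<close> is given by its two node sets, which are the finite
  types \<open>'x\<close> (for \<open>X\<close>) and \<open>'y\<close> (for \<open>Y\<close>); disjointness is automatic, also when \<open>'x\<close> and \<open>'y\<close> are
  instantiated to the same type, since the two kinds of nodes index different components of a
  vector. Since the graph is complete, the edges \<open>{i, j}\<close> with \<open>i \<in> X\<close>, \<open>j \<in> Y\<close> correspond
  one-to-one to the pairs \<open>(i, j)\<close>. The space of vectors indexed by \<open>X \<union> Y \<union> E\<close> is
  the Euclidean space of triples \<open>(x, y, z)\<close> below.
\<close>

type_synonym ('x, 'y) bip_space = "(real ^ 'x) \<times> (real ^ 'y) \<times> (real ^ ('x \<times> 'y))"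

definition X_part :: "'x::finite set set \<Rightarrow> (real ^ 'x) set" where
  "X_part \<I> = {x. (\<forall>i. x $ i \<in> {0, 1}) \<and> (\<forall>I\<in>\<I>. (\<Sum>i\<in>I. x $ i) \<le> 1)}"

definition P_bip :: "'x::finite set set \<Rightarrow> ('x, 'y::finite) bip_space set" where
  "P_bip \<I> = convex hull {(x, y, z).
      (\<forall>i. x $ i \<in> {0, 1}) \<and> (\<forall>j. y $ j \<in> {0, 1}) \<and> (\<forall>e. z $ e \<in> {0, 1}) \<and>
      (\<forall>i j. x $ i * y $ j = z $ (i, j)) \<and> x \<in> X_part \<I>}"

text \<open>The inequality \<open>f v \<le> b\<close> (with \<open>f\<close> linear) is valid for \<open>P\<close>, and the face it induces is a facet.\<close>

definition defines_facet :: "('v::euclidean_space \<Rightarrow> real) \<Rightarrow> real \<Rightarrow> 'v set \<Rightarrow> bool" where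
  "defines_facet f b P \<longleftrightarrow> (\<forall>v\<in>P. f v \<le> b) \<and> {v \<in> P. f v = b} facet_of P"

end

theory Submission
  imports Defs
begin

text \<open>
  The generators of the polytope are the incidence vectors \<open>vert A B\<close>, where \<open>A\<close> meets every part
  at most once. On them the left-hand side equals \<open>\<Sum>\<^sub>p coef p B - [j\<^sub>1 \<in> B]\<close>, summed over
  \<open>i\<^sub>p \<in> A\<close>, where \<open>coef p B \<le> 1\<close>, with equality for at most one \<open>p\<close> (determined by the length of
  the longest initial segment \<open>j\<^sub>1, \<dots>, j\<^sub>r\<close> contained in \<open>B\<close>) and only if \<open>j\<^sub>1 \<in> B\<close>. Hence the
  inequality is valid. For the dimension of the face, a vector that is orthogonal to all tight
  generators and has \<open>y\<close>-entry \<open>0\<close> at \<open>j\<^sub>1\<close> is shown to vanish, by comparing tight generators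
  with \<open>\<bar>A\<bar> \<le> 2\<close> whose sets \<open>B\<close> differ in few elements.
\<close>

section \<open>Incidence vectors as generators of the polytope, and a criterion for facets\<close>

definition vert :: "'x::finite set \<Rightarrow> 'y::finite set \<Rightarrow> ('x, 'y) bip_space" where
  "vert A B = (\<chi> a. of_bool (a \<in> A), \<chi> b. of_bool (b \<in> B),
     \<chi> e. of_bool (fst e \<in> A \<and> snd e \<in> B))"

definition transversal :: "'x set set \<Rightarrow> 'x set \<Rightarrow> bool" where
  "transversal \<I> A \<longleftrightarrow> (\<forall>J\<in>\<I>. card (A \<inter> J) \<le> 1)"

lemma transversal_empty [simp]: "transversal \<I> {}"
  by (simp add: transversal_def)

lemma transversal_singleton [simp]: "transversal \<I> {a}"
  by (auto simp: transversal_def Int_insert_left)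

lemma transversal_pair:
  assumes "\<And>J. J \<in> \<I> \<Longrightarrow> a \<in> J \<Longrightarrow> b \<notin> J"
  shows "transversal \<I> {a, b}"
  using assms by (auto simp: transversal_def Int_insert_left)

lemma P_bip_eq:
  "(P_bip \<I> :: ('x::finite, 'y::finite) bip_space set)
    = convex hull {vert A B |A B. transversal \<I> A}"
proof -
  have part: "(\<Sum>a\<in>J. of_bool (a \<in> A)) = real (card (A \<inter> J))" for A J :: "'a::finite set"
    by (simp add: Int_commute)
  have "{(x, y, z).
      (\<forall>i. x $ i \<in> {0, 1}) \<and> (\<forall>j. y $ j \<in> {0, 1}) \<and> (\<forall>e. z $ e \<in> {0, 1}) \<and>
      (\<forall>i j. x $ i * y $ j = z $ (i, j)) \<and> x \<in> X_part \<I>}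
    = {vert A B :: ('x, 'y) bip_space |A B. transversal \<I> A}" (is "?L = ?R")
  proof (intro equalityI subsetI)
    fix w assume "w \<in> ?L"
    then obtain x y z where w: "w = (x, y, z)" and x: "\<And>i. x $ i = 0 \<or> x $ i = 1"
      and y: "\<And>j. y $ j = 0 \<or> y $ j = 1" and z: "\<And>i j. z $ (i, j) = x $ i * y $ j"
      and X: "\<And>J. J \<in> \<I> \<Longrightarrow> (\<Sum>i\<in>J. x $ i) \<le> 1"
      by (auto simp: X_part_def)
    define A where "A = {i. x $ i = 1}"
    define B where "B = {j. y $ j = 1}"
    have xA: "x $ i = of_bool (i \<in> A)" for i using x[of i] by (auto simp: A_def)
    have yB: "y $ j = of_bool (j \<in> B)" for j using y[of j] by (auto simp: B_def)
    have "w = vert A B"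
      by (auto simp: w vert_def vec_eq_iff xA yB z)
    moreover have "transversal \<I> A"
      using X by (auto simp: transversal_def xA part simp del: sum_of_bool_eq)
    ultimately show "w \<in> ?R" by blast
  next
    fix w assume "w \<in> ?R"
    then show "w \<in> ?L"
      by (auto simp: vert_def X_part_def transversal_def part simp del: sum_of_bool_eq)
  qed
  then show ?thesis by (simp only: P_bip_def)
qed

lemma convex_P_bip: "convex (P_bip \<I>)"
  by (simp add: P_bip_def)

lemma vert_in_P_bip: "transversal \<I> A \<Longrightarrow> vert A B \<in> P_bip \<I>"
  unfolding P_bip_eq by (rule hull_inc) blast

lemma vert_empty [simp]: "vert {} {} = 0"
  by (simp add: vert_def prod_eq_iff vec_eq_iff)

text \<open>The edge terms are grouped by their end in \<open>A\<close>, so that orthogonality to a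
  generator becomes an equation with one bracket per node of \<open>A\<close>; these brackets are
  abbreviated by \<open>R a B\<close> later.\<close>

lemma inner_vert:
  "(x, y, z) \<bullet> vert A B =
    (\<Sum>b\<in>B. y $ b) + (\<Sum>a\<in>A. x $ a + (\<Sum>b\<in>B. z $ (a, b)))"
proof -
  have "(\<Sum>e\<in>UNIV. z $ e * of_bool (fst e \<in> A \<and> snd e \<in> B)) = (\<Sum>e\<in>A \<times> B. z $ e)"
    by (rule sum.mono_neutral_cong_right) auto
  then show ?thesis
    by (simp add: vert_def inner_vec_def of_bool_def if_distrib sum.If_cases sum.distrib
        sum.cartesian_product cong: if_cong)
qed

text \<open>The hypothesis \<open>orth\<close> says that the face together with the single vector
  \<open>e\<close> spans the whole space, so the face has linear dimension at least
  \<open>DIM('v) - 1\<close>. As 0 lies in the face, its linear and affine dimensions agree, and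
  \<open>u\<close> makes the face proper, which leaves codimension exactly one.\<close>

lemma facet_ofI:
  fixes P :: "'v::euclidean_space set" and f :: "'v \<Rightarrow> real"
  assumes "linear f" and "convex P" and valid: "\<And>v. v \<in> P \<Longrightarrow> f v \<le> 0"
    and "0 \<in> P" and "u \<in> P" "f u \<noteq> 0"
    and orth: "\<And>w. w \<bullet> e = 0 \<Longrightarrow> (\<And>v. v \<in> P \<Longrightarrow> f v = 0 \<Longrightarrow> w \<bullet> v = 0) \<Longrightarrow> w = 0"
  shows "{v \<in> P. f v = 0} facet_of P"
proof -
  let ?F = "{v \<in> P. f v = 0}"
  define a where "a = adjoint f 1"
  have f: "f v = a \<bullet> v" for v
    using adjoint_works[OF \<open>linear f\<close>, of v 1] by (simp add: a_def inner_commute)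
  have face: "?F face_of P"
    using face_of_Int_supporting_hyperplane_le[OF \<open>convex P\<close>, of a 0] valid
    by (simp add: f Collect_conj_eq)
  have "0 \<in> ?F" using \<open>0 \<in> P\<close> by (simp add: f)
  have "dim (insert e ?F) = DIM('v)"
  proof (rule ccontr)
    assume "dim (insert e ?F) \<noteq> DIM('v)"
    then have "dim (insert e ?F) < DIM('v)"
      using dim_subset_UNIV[of "insert e ?F"] by linarith
    then obtain w where "w \<noteq> 0" "\<And>v. v \<in> span (insert e ?F) \<Longrightarrow> orthogonal w v"
      using orthogonal_to_vector_exists orthogonal_to_subspace_exists by metis
    then have "w \<noteq> 0" and "\<And>v. v \<in> insert e ?F \<Longrightarrow> w \<bullet> v = 0"
      by (auto simp: orthogonal_def span_base)
    then show False using orth[of w] by auto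
  qed
  moreover have "dim (insert e ?F) \<le> dim ?F + 1"
    by (simp add: dim_insert)
  moreover have "aff_dim ?F = int (dim ?F)"
    using \<open>0 \<in> ?F\<close> by (intro aff_dim_zero hull_inc)
  moreover have "aff_dim ?F < aff_dim P"
    using face_of_aff_dim_lt[OF \<open>convex P\<close> face] \<open>u \<in> P\<close> \<open>f u \<noteq> 0\<close> by auto
  moreover have "aff_dim P \<le> int (DIM('v))"
    by (rule aff_dim_le_DIM)
  ultimately have "aff_dim ?F = aff_dim P - 1" by linarith
  then show ?thesis
    using face \<open>0 \<in> ?F\<close> by (auto simp: facet_of_def)
qed

section \<open>The left-hand side of the inequality on incidence vectors\<close>

locale staircase =
  fixes \<I> :: "'x::finite set set"
    and m :: nat
    and I :: "nat \<Rightarrow> 'x set"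
    and i :: "nat \<Rightarrow> 'x"
    and j :: "nat \<Rightarrow> 'y::finite"
  assumes partition: "partition_on UNIV \<I>"
    and m_ge: "m \<ge> 2"
    and I_in: "k \<in> {1..m} \<Longrightarrow> I k \<in> \<I>"
    and inj_I: "inj_on I {1..m}"
    and i_in: "k \<in> {1..m} \<Longrightarrow> i k \<in> I k"
    and inj_j: "inj_on j {1..m}"
begin

definition lhs :: "('x, 'y) bip_space \<Rightarrow> real" where
  "lhs = (\<lambda>(x, y, z).
        - (y $ j 1)
        - (\<Sum>k=1..m. (real m - real k) * x $ i k)
        - (\<Sum>(p, k)\<in>{(p, k). p \<in> {2..m} \<and> k \<in> {2..m} \<and> p + k = m + 2}. z $ (i p, j k))
        + (\<Sum>(p, k)\<in>{(p, k). p \<in> {1..m} \<and> k \<in> {1..m} \<and> p + k < m + 2}. z $ (i p, j k)))"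

text \<open>This collects everything that the node \<open>i p\<close> contributes to
  \<open>lhs (vert A B)\<close> when it lies in \<open>A\<close>. The condition p + k < m + 2
  becomes k \<le> m + 1 - p, and the antidiagonal p + k = m + 2 leaves the single index m + 2 -
  p.\<close>

definition coef :: "nat \<Rightarrow> 'y set \<Rightarrow> real" where
  "coef p B = (\<Sum>k=1..m+1-p. of_bool (j k \<in> B)) - (real m - real p)
     - of_bool (p \<ge> 2 \<and> j (m + 2 - p) \<in> B)"

lemma linear_lhs: "linear lhs"
  by (rule linearI)
    (auto simp: lhs_def case_prod_beta sum.distrib distrib_left right_diff_distrib sum_distrib_left mult.left_commute)

lemma part_unique: "J \<in> \<I> \<Longrightarrow> k \<in> {1..m} \<Longrightarrow> i k \<in> J \<Longrightarrow> J = I k"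
  using partition_onD2[OF partition] I_in i_in unfolding disjoint_def by blast

lemma inj_i: "inj_on i {1..m}"
proof (rule inj_onI)
  fix p q assume "p \<in> {1..m}" "q \<in> {1..m}" "i p = i q"
  then show "p = q"
    using part_unique[of "I p" q] I_in[of p] i_in[of p] inj_onD[OF inj_I, of p q] by simp
qed

lemma transversal_i_i:
  assumes "p \<in> {1..m}" "q \<in> {1..m}" "p \<noteq> q"
  shows "transversal \<I> {i p, i q}"
  using assms part_unique inj_onD[OF inj_I] by (intro transversal_pair) metis

lemma lhs_vert:
  "lhs (vert A B) = (\<Sum>p | p \<in> {1..m} \<and> i p \<in> A. coef p B) - of_bool (j 1 \<in> B)"
proof -
  have S1: "{(p, k). p \<in> {1..m} \<and> k \<in> {1..m} \<and> p + k < m + 2}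
      = (SIGMA p:{1..m}. {1..m+1-p})" by auto
  have S2: "{(p, k). p \<in> {2..m} \<and> k \<in> {2..m} \<and> p + k = m + 2}
      = (\<lambda>p. (p, m + 2 - p)) ` {2..m}" by (auto simp: image_iff)
  have upper: "(\<Sum>(p, k)\<in>{(p, k). p \<in> {1..m} \<and> k \<in> {1..m} \<and> p + k < m + 2}.
      of_bool (i p \<in> A \<and> j k \<in> B))
      = (\<Sum>p=1..m. of_bool (i p \<in> A) * (\<Sum>k=1..m+1-p. of_bool (j k \<in> B)) :: real)"
    unfolding S1
    by (simp add: sum.Sigma[symmetric] of_bool_conj sum_distrib_left del: sum_of_bool_eq)
  have "(\<Sum>(p, k)\<in>{(p, k). p \<in> {2..m} \<and> k \<in> {2..m} \<and> p + k = m + 2}.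
      of_bool (i p \<in> A \<and> j k \<in> B))
      = (\<Sum>p=2..m. of_bool (i p \<in> A \<and> j (m + 2 - p) \<in> B) :: real)"
    unfolding S2 by (subst sum.reindex) (auto simp: inj_on_def simp del: sum_of_bool_eq)
  \<comment> \<open>The guard \<open>p \<ge> 2\<close> pads the sum with a zero at p = 1, where the
    antidiagonal index m + 1 would be out of range.\<close>
  also have "\<dots> = (\<Sum>p=1..m. of_bool (i p \<in> A) * of_bool (p \<ge> 2 \<and> j (m + 2 - p) \<in> B))"
    by (rule sum.mono_neutral_cong_left) auto
  finally have diag: "(\<Sum>(p, k)\<in>{(p, k). p \<in> {2..m} \<and> k \<in> {2..m} \<and> p + k = m + 2}.
      of_bool (i p \<in> A \<and> j k \<in> B))
      = (\<Sum>p=1..m. of_bool (i p \<in> A) * of_bool (p \<ge> 2 \<and> j (m + 2 - p) \<in> B) :: real)" .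
  have "lhs (vert A B) = - of_bool (j 1 \<in> B)
      - (\<Sum>p=1..m. of_bool (i p \<in> A) * (real m - real p))
      - (\<Sum>p=1..m. of_bool (i p \<in> A) * of_bool (p \<ge> 2 \<and> j (m + 2 - p) \<in> B))
      + (\<Sum>p=1..m. of_bool (i p \<in> A) * (\<Sum>k=1..m+1-p. of_bool (j k \<in> B)))"
    unfolding lhs_def vert_def prod.case vec_lambda_beta fst_conv snd_conv upper diag
    by (simp add: mult.commute)
  also have "\<dots> = (\<Sum>p=1..m. of_bool (i p \<in> A) * coef p B) - of_bool (j 1 \<in> B)"
    unfolding coef_def right_diff_distrib sum_subtractf by simp
  also have "(\<Sum>p=1..m. of_bool (i p \<in> A) * coef p B)
      = (\<Sum>p | p \<in> {1..m} \<and> i p \<in> A. coef p B)"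
    by (rule sum.mono_neutral_cong_right) auto
  finally show ?thesis .
qed

text \<open>The segment 1, ..., m + 1 - p has one index more than the subtracted m - p, so counting
  the missing indices instead of the present ones leaves the constant 1.\<close>

lemma coef_eq:
  assumes "p \<in> {1..m}"
  shows "coef p B = 1 - real (card {k \<in> {1..m+1-p}. j k \<notin> B})
    - of_bool (p \<ge> 2 \<and> j (m + 2 - p) \<in> B)"
proof -
  have "(\<Sum>k=1..m+1-p. of_bool (j k \<in> B) + of_bool (j k \<notin> B)) = (\<Sum>k=1..m+1-p. 1 :: real)"
    by (intro sum.cong) auto
  then have "(\<Sum>k=1..m+1-p. of_bool (j k \<in> B)) + real (card {k \<in> {1..m+1-p}. j k \<notin> B})
      = real (m + 1 - p)"
    by (simp add: sum.distrib Int_def conj_commute)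
  then show ?thesis using assms by (simp add: coef_def of_nat_diff del: sum_of_bool_eq)
qed

lemma coef_eq_1:
  assumes "p \<in> {1..m}" "\<And>k. k \<in> {1..m+1-p} \<Longrightarrow> j k \<in> B"
    and "p \<ge> 2 \<Longrightarrow> j (m + 2 - p) \<notin> B"
  shows "coef p B = 1"
proof -
  have "{k \<in> {1..m+1-p}. j k \<notin> B} = {}" using assms(2) by blast
  then have "card {k \<in> {1..m+1-p}. j k \<notin> B} = 0" by (simp only: card.empty)
  with assms(1,3) show ?thesis by (simp add: coef_eq)
qed

lemma coef_eq_0_full:
  assumes "p \<in> {2..m}" "\<And>k. k \<in> {1..m+2-p} \<Longrightarrow> j k \<in> B"
  shows "coef p B = 0"
proof -
  have "{k \<in> {1..m+1-p}. j k \<notin> B} = {}" using assms(2) by fastforce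
  then have "card {k \<in> {1..m+1-p}. j k \<notin> B} = 0" by (simp only: card.empty)
  moreover have "j (m + 2 - p) \<in> B" using assms by auto
  ultimately show ?thesis using assms(1) by (simp add: coef_eq)
qed

lemma coef_eq_0_missing:
  assumes "p \<in> {1..m}" "s \<in> {1..m+1-p}" "j s \<notin> B"
    and "\<And>k. k \<in> {1..m+1-p} \<Longrightarrow> k \<noteq> s \<Longrightarrow> j k \<in> B"
    and "p \<ge> 2 \<Longrightarrow> j (m + 2 - p) \<notin> B"
  shows "coef p B = 0"
proof -
  have "{k \<in> {1..m+1-p}. j k \<notin> B} = {s}" using assms(2-4) by blast
  then have "card {k \<in> {1..m+1-p}. j k \<notin> B} = 1" by simp
  with assms(1,5) show ?thesis by (simp add: coef_eq)
qed

text \<open>By \<open>coef_eq\<close> the coefficient is 1 minus two natural numbers, so positivity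
  forces both to vanish.\<close>

lemma coef_pos:
  assumes "p \<in> {1..m}" "coef p B > 0"
  shows "coef p B = 1" "\<And>k. k \<in> {1..m+1-p} \<Longrightarrow> j k \<in> B" "p \<ge> 2 \<Longrightarrow> j (m + 2 - p) \<notin> B"
proof -
  have "card {k \<in> {1..m+1-p}. j k \<notin> B} = 0" and *: "\<not> (p \<ge> 2 \<and> j (m + 2 - p) \<in> B)"
    using assms by (auto simp only: coef_eq of_bool_def split: if_splits)
  then have "{k \<in> {1..m+1-p}. j k \<notin> B} = {}" by simp
  then show "\<And>k. k \<in> {1..m+1-p} \<Longrightarrow> j k \<in> B" by blast
  moreover show "p \<ge> 2 \<Longrightarrow> j (m + 2 - p) \<notin> B" using * by blast
  ultimately show "coef p B = 1" using assms(1) by (intro coef_eq_1)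
qed

text \<open>For p < q the index m + 2 - q belongs to the segment that p needs inside
  \<open>B\<close>, while q needs it outside.\<close>

lemma coef_pos_unique:
  assumes "p \<in> {1..m}" "q \<in> {1..m}" "coef p B > 0" "coef q B > 0"
  shows "p = q"
proof -
  have False if "p \<in> {1..m}" "q \<in> {1..m}" "coef p B > 0" "coef q B > 0" "p < q" for p q
  proof -
    have "m + 2 - q \<in> {1..m+1-p}" "q \<ge> 2" using that by auto
    then show False using coef_pos(2)[of p B "m + 2 - q"] coef_pos(3)[of q B] that by blast
  qed
  with assms show ?thesis by (metis nat_neq_iff)
qed

section \<open>Validity of the inequality\<close>

lemma lhs_vert_le: "lhs (vert A B) \<le> 0"
proof -
  let ?T = "{p. p \<in> {1..m} \<and> i p \<in> A}"
  show ?thesis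
  proof (cases "\<exists>p\<in>?T. coef p B > 0")
    case True
    then obtain p where p: "p \<in> ?T" "coef p B > 0" by blast
    have "(\<Sum>q\<in>?T. coef q B) = coef p B + (\<Sum>q\<in>?T - {p}. coef q B)"
      using p by (intro sum.remove) auto
    moreover have "(\<Sum>q\<in>?T - {p}. coef q B) \<le> 0"
    proof (rule sum_nonpos)
      fix q assume "q \<in> ?T - {p}"
      then show "coef q B \<le> 0" using p coef_pos_unique[of p q B] by force
    qed
    moreover have "coef p B = 1"
      using p coef_pos(1)[of p B] by simp
    moreover have "1 \<in> {1..m+1-p}"
      using p by auto
    then have "j 1 \<in> B"
      using p coef_pos(2)[of p B] by blast
    ultimately show ?thesis by (simp add: lhs_vert)
  next
    case False
    then have "(\<Sum>q\<in>?T. coef q B) \<le> 0" by (intro sum_nonpos) (meson leI)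
    then show ?thesis by (simp add: lhs_vert)
  qed
qed

lemma lhs_le: "v \<in> P_bip \<I> \<Longrightarrow> lhs v \<le> 0"
proof -
  assume v: "v \<in> P_bip \<I>"
  have "lhs w = adjoint lhs 1 \<bullet> w" for w
    using adjoint_works[OF linear_lhs, of w 1] by (simp add: inner_commute)
  then have "convex {w. lhs w \<le> 0}" by (simp add: convex_halfspace_le)
  then have "P_bip \<I> \<subseteq> {w. lhs w \<le> 0}"
    unfolding P_bip_eq by (intro hull_minimal) (auto simp: lhs_vert_le)
  with v show ?thesis by blast
qed

section \<open>Tight generators and the dimension of the face\<close>

lemma j_mem: "k \<in> {1..m} \<Longrightarrow> K \<subseteq> {1..m} \<Longrightarrow> j k \<in> j ` K \<longleftrightarrow> k \<in> K"
  using inj_on_image_mem_iff[OF inj_j] by blast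

lemma j_notin: "k \<in> {1..m} \<Longrightarrow> K \<subseteq> {1..m} \<Longrightarrow> k \<notin> K \<Longrightarrow> j k \<notin> j ` K"
  by (simp add: j_mem)

lemma tight_no_i: "A \<inter> i ` {1..m} = {} \<Longrightarrow> j 1 \<notin> B \<Longrightarrow> lhs (vert A B) = 0"
proof -
  assume "A \<inter> i ` {1..m} = {}" "j 1 \<notin> B"
  then have "{p. p \<in> {1..m} \<and> i p \<in> A} = {}" by blast
  with \<open>j 1 \<notin> B\<close> show ?thesis unfolding lhs_vert by (simp only: sum.empty of_bool_eq diff_zero)
qed

lemma tight_one_i:
  assumes "A \<inter> i ` {1..m} = {i p}" "p \<in> {1..m}" "coef p B = of_bool (j 1 \<in> B)"
  shows "lhs (vert A B) = 0"
proof -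
  have "{q. q \<in> {1..m} \<and> i q \<in> A} = {p}"
    using assms inj_onD[OF inj_i] by blast
  with assms show ?thesis unfolding lhs_vert by simp
qed

lemma tight_two_i:
  assumes "p \<in> {1..m}" "q \<in> {1..m}" "p \<noteq> q" "coef p B + coef q B = of_bool (j 1 \<in> B)"
  shows "lhs (vert {i p, i q} B) = 0"
proof -
  have "{k. k \<in> {1..m} \<and> i k \<in> {i p, i q}} = {p, q}"
    using assms inj_onD[OF inj_i] by blast
  with assms show ?thesis unfolding lhs_vert by simp
qed

text \<open>The normal vector of \<open>lhs\<close> is itself orthogonal to the face and has y-entry
  -1 at \<open>j 1\<close>. The condition \<open>y1\<close> excludes its nonzero multiples, and the
  claim is that nothing else remains.\<close>

lemma orthogonal_to_face_imp_0:
  assumes orth: "\<And>v. v \<in> P_bip \<I> \<Longrightarrow> lhs v = 0 \<Longrightarrow> (x, y, z) \<bullet> v = 0"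
    and y1: "y $ j 1 = 0"
  shows "x = 0" "y = 0" "z = 0"
proof -
  have mem1: "1 \<in> {1..m}" and mem_m: "m \<in> {1..m}" using m_ge by auto
  define R where "R a B = x $ a + (\<Sum>b\<in>B. z $ (a, b))" for a B
  have tight: "(\<Sum>b\<in>B. y $ b) + (\<Sum>a\<in>A. R a B) = 0"
    if "transversal \<I> A" "lhs (vert A B) = 0" for A B
    using orth[OF vert_in_P_bip[OF that(1)] that(2)] by (simp add: inner_vert R_def)
  have y0: "y $ b = 0" for b
    using tight[OF transversal_empty, of "{b}"] y1 by (cases "b = j 1") (auto simp: tight_no_i)
  have R1: "R a B = 0" if "lhs (vert {a} B) = 0" for a B
    using tight[of "{a}" B] that by (simp add: y0)
  have R2: "R a B + R b B = 0" if "a \<noteq> b" "transversal \<I> {a, b}" "lhs (vert {a, b} B) = 0" for a b B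
    using tight[of "{a, b}" B] that by (simp add: y0)
  have R_insert: "R a (insert b B) = R a B + z $ (a, b)" if "b \<notin> B" for a b B
    using that by (simp add: R_def)

  \<comment> \<open>The shortest set with \<open>coef\<close> equal to 1 at p. The following steps
    compare other tight sets with it.\<close>
  have initial: "R (i p) (j ` {1..m+1-p}) = 0" if p: "p \<in> {1..m}" for p
  proof (rule R1, rule tight_one_i[OF _ p])
    have "coef p (j ` {1..m+1-p}) = 1"
    proof (rule coef_eq_1[OF p])
      show "p \<ge> 2 \<Longrightarrow> j (m + 2 - p) \<notin> j ` {1..m+1-p}"
        by (rule j_notin) (use p in auto)
    qed auto
    then show "coef p (j ` {1..m+1-p}) = of_bool (j 1 \<in> j ` {1..m+1-p})"
      using p by auto
  qed (use p in auto)

  \<comment> \<open>Sets \<open>B\<close> without \<open>j 1\<close> are tight with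
    \<open>{a}\<close> alone. To reach the entry at \<open>j 1\<close>, the node \<open>a\<close> is
    paired with some \<open>i p\<close> of coefficient 1 from another part: p = m in general, and p
    = 1 if \<open>a\<close> lies in \<open>I m\<close>.\<close>
  have other_x: "R a {} = 0 \<and> z $ (a, b) = 0" if a: "a \<notin> i ` {1..m}" for a b
  proof -
    have Ra: "R a B = 0" if "j 1 \<notin> B" for B
      using that a by (intro R1 tight_no_i) auto
    have z_ne: "z $ (a, b) = 0" if "b \<noteq> j 1" for b
      using Ra[of "{b}"] Ra[of "{}"] that by (simp add: R_def)
    have ex: "\<exists>B. j 1 \<in> B \<and> R a B = 0"
    proof (cases "a \<in> I m")
      case False
      \<comment> \<open>For p = m the required segment is just 1, and the excluded index is
        2.\<close>
      have c: "coef m {j 1} = 1"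
        using m_ge inj_onD[OF inj_j, of 2 1] by (intro coef_eq_1) auto
      have "transversal \<I> {i m, a}"
        using False part_unique[OF _ mem_m] by (intro transversal_pair) blast
      moreover have "lhs (vert {i m, a} {j 1}) = 0"
        using a c mem_m by (intro tight_one_i[of _ m]) auto
      ultimately have "R (i m) {j 1} + R a {j 1} = 0"
        using a mem_m by (intro R2) auto
      moreover have "R (i m) {j 1} = 0" using initial[OF mem_m] by simp
      ultimately show ?thesis by auto
    next
      case True
      have "I 1 \<noteq> I m" using inj_onD[OF inj_I _ mem1 mem_m] m_ge by auto
      then have "a \<notin> I 1"
        using True partition_onD2[OF partition] I_in[OF mem1] I_in[OF mem_m]
        unfolding disjoint_def by blast
      then have "transversal \<I> {i 1, a}"
        using part_unique[OF _ mem1] by (intro transversal_pair) blast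
      moreover have "coef 1 (j ` {1..m}) = 1"
        using mem1 by (intro coef_eq_1) auto
      then have "lhs (vert {i 1, a} (j ` {1..m})) = 0"
        using a mem1 by (intro tight_one_i[of _ 1]) auto
      ultimately have "R (i 1) (j ` {1..m}) + R a (j ` {1..m}) = 0"
        using a mem1 by (intro R2) auto
      moreover have "R (i 1) (j ` {1..m}) = 0" using initial[OF mem1] by simp
      moreover have "j 1 \<in> j ` {1..m}" using mem1 by blast
      ultimately show ?thesis by auto
    qed
    then obtain B where B: "j 1 \<in> B" "R a B = 0" by blast
    have "R a B = R a (B - {j 1}) + z $ (a, j 1)"
      using R_insert[of "j 1" "B - {j 1}" a] B by (simp add: insert_absorb)
    then have "z $ (a, j 1) = 0" using B Ra[of "B - {j 1}"] by simp
    then show ?thesis using z_ne Ra[of "{}"] by (cases "b = j 1") auto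
  qed

  \<comment> \<open>Adding a node outside the chosen \<open>j k\<close> leaves \<open>coef\<close>
    unchanged, so the set stays tight.\<close>
  have other_y: "z $ (i p, b) = 0" if p: "p \<in> {1..m}" and b: "b \<notin> j ` {1..m}" for p b
  proof -
    let ?B = "insert b (j ` {1..m+1-p})"
    have nb: "b \<noteq> j k" if "k \<in> {1..m}" for k using b that by blast
    have "coef p ?B = 1"
    proof (rule coef_eq_1[OF p])
      assume "p \<ge> 2"
      then have "m + 2 - p \<in> {1..m}" using p by auto
      moreover have "j (m + 2 - p) \<notin> j ` {1..m+1-p}"
        by (rule j_notin) (use p \<open>p \<ge> 2\<close> in auto)
      ultimately show "j (m + 2 - p) \<notin> ?B" using nb by blast
    qed auto
    then have "R (i p) ?B = 0"
      using p by (intro R1 tight_one_i[OF _ p]) auto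
    moreover have "b \<notin> j ` {1..m+1-p}" using b p by auto
    ultimately show ?thesis using initial[OF p] by (simp add: R_insert)
  qed

  \<comment> \<open>Leaving out \<open>j 1\<close> makes both \<open>coef\<close> and the term for
    \<open>j 1\<close> vanish. Indices above m + 2 - p do not affect \<open>coef p\<close>, so
    \<open>K\<close> may contain them freely.\<close>
  have shifted: "R (i p) (j ` K) = 0"
    if p: "p \<in> {1..m}" and K: "{2..m+1-p} \<subseteq> K" "K \<subseteq> {2..m}" "m + 2 - p \<notin> K" for p K
  proof (rule R1, rule tight_one_i[OF _ p])
    have sub: "K \<subseteq> {1..m}" using K by auto
    have n1: "j 1 \<notin> j ` K" using j_mem[OF mem1 sub] K by auto
    have "coef p (j ` K) = 0"
    proof (rule coef_eq_0_missing[OF p, of 1])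
      show "p \<ge> 2 \<Longrightarrow> j (m + 2 - p) \<notin> j ` K"
        by (rule j_notin) (use sub K p in auto)
      fix k assume "k \<in> {1..m+1-p}" "k \<noteq> 1"
      then have "k \<in> K" using K(1) by auto
      then show "j k \<in> j ` K" by blast
    qed (use p n1 in auto)
    with n1 show "coef p (j ` K) = of_bool (j 1 \<in> j ` K)" by simp
  qed (use p in auto)

  have R_j_insert: "R a (j ` insert k K) = R a (j ` K) + z $ (a, j k)"
    if "k \<in> {1..m}" "K \<subseteq> {1..m}" "k \<notin> K" for a k K
    using R_insert[of "j k" "j ` K" a] that by (simp add: j_mem)

  have R_j_extend: "R a (j ` K) = R a (j ` K')"
    if "K' \<subseteq> K" "K \<subseteq> {1..m}" "\<And>k. k \<in> K - K' \<Longrightarrow> z $ (a, j k) = 0" for a K K'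
    unfolding R_def using that by (intro arg_cong2[of _ _ _ _ "(+)"] refl sum.mono_neutral_right) auto

  have R_shifted: "R (i p) (j ` {2..m+1-p}) = 0" if p: "p \<in> {1..m}" for p
    by (rule shifted[OF p]) (use p in auto)

  \<comment> \<open>The sets in \<open>initial\<close> and \<open>R_shifted\<close> differ in
    \<open>j 1\<close> only.\<close>
  have z_first: "z $ (i p, j 1) = 0" if p: "p \<in> {1..m}" for p
  proof -
    have "{1..m+1-p} = insert 1 {2..m+1-p}" using p by auto
    moreover have "R (i p) (j ` insert 1 {2..m+1-p})
        = R (i p) (j ` {2..m+1-p}) + z $ (i p, j 1)"
      using p by (intro R_j_insert) auto
    ultimately show ?thesis using initial[OF p] R_shifted[OF p] by simp
  qed

  have z_above: "z $ (i p, j k) = 0" if p: "p \<in> {1..m}" and k: "k \<in> {m+3-p..m}" for p k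
  proof -
    have "R (i p) (j ` insert k {2..m+1-p}) = R (i p) (j ` {2..m+1-p}) + z $ (i p, j k)"
      using p k by (intro R_j_insert) auto
    moreover have "R (i p) (j ` insert k {2..m+1-p}) = 0"
      by (rule shifted[OF p]) (use p k in auto)
    ultimately show ?thesis using R_shifted[OF p] by simp
  qed

  \<comment> \<open>With all \<open>j k\<close> in \<open>B\<close>, the node \<open>i 1\<close> has
    coefficient 1 and \<open>i p\<close> has coefficient 0, so the pair is tight. By
    \<open>z_above\<close> the full set may then be cut down to the indices up to m + 2 - p, one
    more than in \<open>initial\<close>.\<close>
  have z_diag: "z $ (i p, j (m + 2 - p)) = 0" if p: "p \<in> {2..m}" for p
  proof -
    have p': "p \<in> {1..m}" "1 \<noteq> p" using p by auto
    have "coef 1 (j ` {1..m}) = 1" using mem1 by (intro coef_eq_1) auto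
    moreover have "coef p (j ` {1..m}) = 0" using p by (intro coef_eq_0_full) auto
    ultimately have "lhs (vert {i 1, i p} (j ` {1..m})) = 0"
      using mem1 p' by (intro tight_two_i) auto
    moreover have "i 1 \<noteq> i p" using inj_onD[OF inj_i _ mem1 p'(1)] p' by auto
    ultimately have "R (i 1) (j ` {1..m}) + R (i p) (j ` {1..m}) = 0"
      using transversal_i_i[OF mem1 p'] by (intro R2)
    then have "R (i p) (j ` {1..m}) = 0" using initial[OF mem1] by simp
    moreover have "R (i p) (j ` {1..m}) = R (i p) (j ` insert (m + 2 - p) {1..m+1-p})"
      using p p' by (intro R_j_extend z_above) auto
    moreover have "\<dots> = R (i p) (j ` {1..m+1-p}) + z $ (i p, j (m + 2 - p))"
      using p by (intro R_j_insert) auto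
    ultimately show ?thesis using initial[OF p'(1)] by simp
  qed

  \<comment> \<open>Removing s from the segment of p lowers \<open>coef p\<close> to 0. The loss is
    compensated by the row q whose excluded index m + 2 - q is s: its segment ends at s - 1, so its
    coefficient is 1. Since s \<ge> 2, \<open>j 1\<close> stays in the set and the pair is
    tight.\<close>
  have z_below: "z $ (i p, j s) = 0" if p: "p \<in> {1..m}" and s: "s \<in> {2..m+1-p}" for p s
  proof -
    define q where "q = m + 2 - s"
    let ?K = "{1..m+1-p} - {s}"
    have q: "q \<in> {2..m}" "q \<in> {1..m}" "p \<noteq> q" "m + 2 - q = s" "m + 1 - q = s - 1"
      using p s by (auto simp: q_def)
    have sub: "?K \<subseteq> {1..m}" "{1..m+1-p} \<subseteq> {1..m}" using p by auto
    have s_notin: "j s \<notin> j ` ?K" by (rule j_notin) (use p s in auto)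
    have "coef p (j ` ?K) = 0"
    proof (rule coef_eq_0_missing[OF p, of s])
      show "p \<ge> 2 \<Longrightarrow> j (m + 2 - p) \<notin> j ` ?K"
        by (rule j_notin) (use p in auto)
      fix k assume "k \<in> {1..m+1-p}" "k \<noteq> s"
      then show "j k \<in> j ` ?K" by blast
    qed (use s s_notin in auto)
    moreover have "coef q (j ` ?K) = 1"
      using q s s_notin by (intro coef_eq_1) auto
    moreover have "j 1 \<in> j ` ?K" using p s by auto
    ultimately have "lhs (vert {i p, i q} (j ` ?K)) = 0"
      using p q by (intro tight_two_i) auto
    moreover have "i p \<noteq> i q" using inj_onD[OF inj_i _ p q(2)] q by auto
    ultimately have "R (i p) (j ` ?K) + R (i q) (j ` ?K) = 0"
      using transversal_i_i[OF p q(2,3)] by (intro R2)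
    \<comment> \<open>The elements of \<open>?K\<close> beyond s - 1 exceed s, hence are at least m
      + 3 - q, where \<open>z_above\<close> applies.\<close>
    moreover have "R (i q) (j ` ?K) = R (i q) (j ` {1..m+1-q})"
      using q p s by (intro R_j_extend z_above) auto
    ultimately have "R (i p) (j ` ?K) = 0" using initial[OF q(2)] by simp
    moreover have "R (i p) (j ` insert s ?K) = R (i p) (j ` ?K) + z $ (i p, j s)"
      using p s sub by (intro R_j_insert) auto
    moreover have "insert s ?K = {1..m+1-p}" using s by auto
    ultimately show ?thesis using initial[OF p] by (simp only: add_0)
  qed

  have z_grid: "z $ (i p, j k) = 0" if p: "p \<in> {1..m}" and k: "k \<in> {1..m}" for p k
  proof -
    consider "k = 1" | "k \<in> {2..m+1-p}" | "k = m + 2 - p" "p \<in> {2..m}" | "k \<in> {m+3-p..m}"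
      using p k by force
    then show ?thesis
    proof cases
      case 1
      then show ?thesis using z_first[OF p] by simp
    next
      case 2
      then show ?thesis using z_below[OF p] by blast
    next
      case 3
      then show ?thesis using z_diag[of p] by (simp only:)
    next
      case 4
      then show ?thesis using z_above[OF p] by blast
    qed
  qed
  have z0: "z $ (a, b) = 0" for a b
    using other_x[of a b] other_y[of _ b] z_grid by (cases "a \<in> i ` {1..m}"; cases "b \<in> j ` {1..m}") auto
  \<comment> \<open>Once \<open>z\<close> vanishes, \<open>R a B\<close> reduces to the entry of
    \<open>x\<close> at \<open>a\<close>.\<close>
  have "x $ a = 0" for a
    using initial other_x[of a] by (cases "a \<in> i ` {1..m}") (auto simp: R_def z0)
  then show "x = 0" by (simp add: vec_eq_iff)
  show "y = 0" by (simp add: vec_eq_iff y0)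
  show "z = 0" by (simp add: vec_eq_iff z0)
qed

lemma lhs_facet: "{v \<in> P_bip \<I>. lhs v = 0} facet_of P_bip \<I>"
proof (rule facet_ofI[OF linear_lhs convex_P_bip lhs_le])
  show "0 \<in> P_bip \<I>" using vert_in_P_bip[of \<I> "{}" "{}"] by simp
  \<comment> \<open>This generator serves twice: \<open>lhs\<close> is -1 there, so the face is
    proper, and orthogonality to it is exactly the normalisation \<open>y1\<close>.\<close>
  show "vert {} {j 1} \<in> P_bip \<I>" by (simp add: vert_in_P_bip)
  show "lhs (vert {} {j 1}) \<noteq> 0" by (simp add: lhs_vert)
next
  fix w :: "('x, 'y) bip_space"
  obtain x y z where w: "w = (x, y, z)" by (cases w)
  assume "w \<bullet> vert {} {j 1} = 0" "\<And>v. v \<in> P_bip \<I> \<Longrightarrow> lhs v = 0 \<Longrightarrow> w \<bullet> v = 0"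
  then have "x = 0" "y = 0" "z = 0"
    using orthogonal_to_face_imp_0[of x y z] by (simp_all add: w inner_vert)
  then show "w = 0" by (simp add: w zero_prod_def)
qed

end

theorem theorem3p8:
  fixes \<I> :: "'x::finite set set"
    and m :: nat
    and I :: "nat \<Rightarrow> 'x set"
    and i :: "nat \<Rightarrow> 'x"
    and j :: "nat \<Rightarrow> 'y::finite"
  assumes "partition_on UNIV \<I>"
    and "m \<ge> 2"
    and "\<forall>k\<in>{1..m}. I k \<in> \<I>"
    and "inj_on I {1..m}"
    and "\<forall>k\<in>{1..m}. i k \<in> I k"
    and "inj_on j {1..m}"
  shows "defines_facet
     (\<lambda>(x, y, z).
        - (y $ j 1)
        - (\<Sum>k=1..m. (real m - real k) * x $ i k)
        - (\<Sum>(p, k)\<in>{(p, k). p \<in> {2..m} \<and> k \<in> {2..m} \<and> p + k = m + 2}. z $ (i p, j k))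
        + (\<Sum>(p, k)\<in>{(p, k). p \<in> {1..m} \<and> k \<in> {1..m} \<and> p + k < m + 2}. z $ (i p, j k)))
     0 (P_bip \<I> :: ('x, 'y) bip_space set)"
proof -
  interpret staircase \<I> m I i j
    using assms by (simp add: staircase_def)
  show ?thesis
    using lhs_le lhs_facet unfolding defines_facet_def lhs_def by blast
qed

end
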